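(* Let $\mathcal{S}'$ be an associative unital $\mathbf{Q}$-algebra, $\mathcal{S}\subset\mathcal{S}'$ a commutative subalgebra, $x\in\mathcal{S}'$ an element such that the commutator $D(r):=[r,x]=rx-xr$ maps $\mathcal{S}$ into $\mathcal{S}$ (so $D$ is a $\mathbf{Q}$-linear derivation of $\mathcal{S}$), and let $F\in\mathcal{S}$. Let $\lambda$ be a formal variable (central), and let $\{A_{s,l}\}$ be the double sequence in $\mathcal{S}$ associated to $F$ and $D$ (defined recursively in the context). Put $$\alpha=\sum_{l=1}^\infty \frac{\lambda^l}{l!}A_{1,l}\in\mathcal{S}[[\lambda]].$$ Then in $\mathcal{S}'[[\lambda]]$ $$ \exp(\lambda xF)=\sum_{s=0}^\infty\frac{x^s\alpha^s}{s!}. $$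
   Context: Given a commutative ring $\mathcal{S}$, an element $F\in\mathcal{S}$ and a derivation $D$ of $\mathcal{S}$, the double sequence $\{A_{s,l}\}$ in $\mathcal{S}$ is defined as follows: $A_{s,l}=0$ unless $0\leq s\leq l$; $A_{0,0}=1$; and, for all $l\geq 0$ and $0\le s\le l+1$, $A_{s,l+1}=F\cdot\bigl(D(A_{s,l})+A_{s-1,l}\bigr)$. In particular $A_{1,l}=(FD)^{l-1}(F)$ for $l\geq 1$, where $FD$ denotes the map $a\mapsto F\cdot D(a)$. In general $x$ and $\alpha$ do not commute; in each summand $x^s\alpha^s$ all factors $x$ stand to the left. The exponential is $\exp(\lambda xF)=\sum_{l\ge 0}\lambda^l (xF)^l/l!$, and the right-hand side converges $\lambda$-adically since $\alpha$ is divisible by $\lambda$. *)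

theory Defs
  imports "HOL-Computational_Algebra.Formal_Power_Series"
begin

(* Associative unital algebras over the rationals, in the style of real_algebra_1. *)
class rat_algebra_1 = ring_1 +
  fixes scaleQ :: "rat \<Rightarrow> 'a \<Rightarrow> 'a"  (infixr \<open>*\<^sub>Q\<close> 75)
  assumes scaleQ_add_right: "a *\<^sub>Q (x + y) = a *\<^sub>Q x + a *\<^sub>Q y"
    and scaleQ_add_left: "(a + b) *\<^sub>Q x = a *\<^sub>Q x + b *\<^sub>Q x"
    and scaleQ_scaleQ: "a *\<^sub>Q b *\<^sub>Q x = (a * b) *\<^sub>Q x"
    and scaleQ_one: "1 *\<^sub>Q x = x"
    and mult_scaleQ_left: "a *\<^sub>Q x * y = a *\<^sub>Q (x * y)"
    and mult_scaleQ_right: "x * a *\<^sub>Q y = a *\<^sub>Q (x * y)"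

global_interpretation rat_vector: vector_space "scaleQ :: rat \<Rightarrow> 'a \<Rightarrow> 'a :: rat_algebra_1"
  by unfold_locales (simp_all add: scaleQ_add_right scaleQ_add_left scaleQ_scaleQ scaleQ_one)

definition rat_subalgebra :: "'a :: rat_algebra_1 set \<Rightarrow> bool" where
  "rat_subalgebra S \<longleftrightarrow>
     rat_vector.subspace S \<and> 1 \<in> S \<and> (\<forall>a\<in>S. \<forall>b\<in>S. a * b \<in> S)"

definition commutator :: "'a :: ring \<Rightarrow> 'a \<Rightarrow> 'a" where
  "commutator a b = a * b - b * a"

(* A_seq F D s l is A_{s,l}; the terms with s = -1 are zero and have been dropped. *)
fun A_seq :: "'a :: ring_1 \<Rightarrow> ('a \<Rightarrow> 'a) \<Rightarrow> nat \<Rightarrow> nat \<Rightarrow> 'a" where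
  "A_seq F D 0 0 = 1"
| "A_seq F D (Suc s) 0 = 0"
| "A_seq F D 0 (Suc l) = F * D (A_seq F D 0 l)"
| "A_seq F D (Suc s) (Suc l) =
     (if Suc s \<le> Suc l then F * (D (A_seq F D (Suc s) l) + A_seq F D s l) else 0)"

instantiation fps :: (rat_algebra_1) rat_algebra_1
begin

definition scaleQ_fps :: "rat \<Rightarrow> 'a fps \<Rightarrow> 'a fps" where
  "scaleQ_fps c f = Abs_fps (\<lambda>n. c *\<^sub>Q fps_nth f n)"

instance
  by standard
    (simp_all add: fps_eq_iff scaleQ_fps_def fps_mult_nth scaleQ_add_right scaleQ_add_left
      scaleQ_scaleQ scaleQ_one mult_scaleQ_left mult_scaleQ_right
      rat_vector.scale_sum_right)

end

(* The sum is taken in the metric of the type fps, which induces the adic topology of the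
   formal variable.  It is meaningful when f has zero constant term. *)
definition exp_series :: "'a :: rat_algebra_1 fps \<Rightarrow> 'a fps" where
  "exp_series f = (\<Sum>l. (1 / fact l) *\<^sub>Q f ^ l)"

lemma exp_series_fps_X_const_sums:
  fixes a :: "'a :: rat_algebra_1"
  shows "(\<lambda>l. (1 / fact l) *\<^sub>Q (fps_X * fps_const a) ^ l)
           sums Abs_fps (\<lambda>n. (1 / fact n) *\<^sub>Q a ^ n)"
proof -
  have "(fps_X * fps_const a) ^ l = fps_const (a ^ l) * fps_X ^ l" for l
  proof (induction l)
    case (Suc l)
    have "(fps_X * fps_const a) ^ Suc l = fps_const a * (fps_X * fps_const (a ^ l)) * fps_X ^ l"
      unfolding power_Suc Suc by (simp only: fps_mult_fps_X_commute mult.assoc)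
    also have "\<dots> = fps_const (a ^ Suc l) * fps_X ^ Suc l"
      by (simp only: fps_mult_fps_X_commute[of "fps_const (a ^ l)"] mult.assoc power_Suc
            flip: fps_const_mult)
    finally show ?case .
  qed simp
  then have term_eq: "(1 / fact l) *\<^sub>Q (fps_X * fps_const a) ^ l
               = fps_const ((1 / fact l) *\<^sub>Q a ^ l) * fps_X ^ l" for l
    by (simp add: fps_eq_iff scaleQ_fps_def mult_scaleQ_left)
  have "(\<lambda>n. \<Sum>l=0..n. fps_const ((1 / fact l) *\<^sub>Q a ^ l) * fps_X ^ l)
          \<longlonglongrightarrow> Abs_fps (\<lambda>n. (1 / fact n) *\<^sub>Q a ^ n)"
    using fps_notation[of "Abs_fps (\<lambda>n. (1 / fact n) *\<^sub>Q a ^ n)"] by simp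
  then show ?thesis
    by (simp add: term_eq sums_def_le atMost_atLeast0)
qed

end

theory Submission
  imports Defs
begin

unbundle fps_syntax

text \<open>
  Moving \<open>x\<close> to the left through \<open>r * x = x * r + D r\<close> gives
  \<open>(x * F) ^ l = (\<Sum>s\<le>l. x ^ s * A_seq F D s l)\<close>. By the recursion, the generating functions
  \<open>G s\<close> of the sequences \<open>A_seq F D s l / l!\<close> satisfy
  \<open>fps_deriv (G (s + 1)) = F * (D (G (s + 1)) + G s)\<close>. By the case \<open>s = 0\<close> of this equation and
  the power rule for the two derivations \<open>fps_deriv\<close> and \<open>D\<close>, the powers \<open>\<alpha> ^ s / s!\<close> satisfy the
  same equations, whose solutions are determined by their constant terms.
\<close>

section \<open>Rational scalars, commutators and derivations\<close>

lemma scaleQ_of_nat: "of_nat n *\<^sub>Q x = of_nat n * (x :: 'a :: rat_algebra_1)"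
  by (induction n) (simp_all add: scaleQ_add_left scaleQ_one algebra_simps)

lemma fps_nth_scaleQ [simp]: "(c *\<^sub>Q f) $ n = c *\<^sub>Q (f $ n)"
  by (simp add: scaleQ_fps_def)

lemma scaleQ_of_nat_mult:
  "c *\<^sub>Q (of_nat n * x) = (c * of_nat n) *\<^sub>Q (x :: 'a :: rat_algebra_1)"
  by (simp add: scaleQ_scaleQ flip: scaleQ_of_nat)

lemma fps_deriv_scaleQ: "fps_deriv (c *\<^sub>Q f) = c *\<^sub>Q fps_deriv f"
  by (simp add: fps_eq_iff mult_scaleQ_right del: of_nat_Suc)

text \<open>Positive integers are invertible in a \<open>\<rat>\<close>-algebra, so scaling by
  \<open>1 / of_nat (Suc n)\<close> undoes the multiplication.\<close>

lemma of_nat_Suc_mult_cancel: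
  fixes a b :: "'a :: rat_algebra_1"
  assumes "of_nat (Suc n) * a = of_nat (Suc n) * b"
  shows "a = b"
proof -
  have "(1 / of_nat (Suc n)) *\<^sub>Q (of_nat (Suc n) * a) = a" for a :: 'a
    by (simp add: scaleQ_of_nat_mult scaleQ_one del: of_nat_Suc)
  with assms show ?thesis by metis
qed

lemma one_div_fact_Suc_mult: "(1 / fact (Suc n)) * of_nat (Suc n) = (1 / fact n :: rat)"
  by (simp add: field_simps del: of_nat_Suc)

lemma commutator_mult_left: "commutator (a * b) c = a * commutator b c + commutator a c * b"
  by (simp add: commutator_def algebra_simps)

lemma commutator_scaleQ_left: "commutator (q *\<^sub>Q a) c = q *\<^sub>Q commutator a c"
  by (simp add: commutator_def mult_scaleQ_left mult_scaleQ_right rat_vector.scale_right_diff_distrib)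

lemma fps_nth_commutator_const: "commutator f (fps_const c) $ n = commutator (f $ n) c"
  by (simp add: commutator_def)

text \<open>Leibniz rule and induction; as the ring is noncommutative, \<open>comm\<close> is what
  allows every factor \<open>d a\<close> to be collected on the right. The map \<open>d\<close> is
  kept abstract to cover both \<open>fps_deriv\<close> and the commutator with
  \<open>fps_const x\<close>.\<close>

lemma derivation_power_Suc:
  fixes d :: "'a :: ring_1 \<Rightarrow> 'a"
  assumes leibniz: "\<And>a b. d (a * b) = a * d b + d a * b"
    and comm: "a * d a = d a * a"
  shows "d (a ^ Suc n) = of_nat (Suc n) * (a ^ n * d a)"
proof (induction n)
  case (Suc n)
  have "d (a ^ Suc (Suc n)) = a * (of_nat (Suc n) * (a ^ n * d a)) + d a * a ^ Suc n"
    by (simp only: power_Suc[of a "Suc n"] leibniz Suc)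
  also have "d a * a ^ Suc n = a ^ Suc n * d a"
    by (rule power_commuting_commutes[OF comm, symmetric])
  also have "a * (of_nat (Suc n) * (a ^ n * d a)) = of_nat (Suc n) * (a ^ Suc n * d a)"
    by (simp only: power_Suc mult_of_nat_commute[of _ a] flip: mult.assoc)
  finally show ?case
    by (simp only: of_nat_Suc[of "Suc n"] distrib_right mult_1_left add.commute)
qed simp

text \<open>Reversing the convolution sum swaps the factors. This carries the commutativity of
  \<open>S\<close> over to power series with coefficients in \<open>S\<close>.\<close>

lemma fps_mult_commuteI:
  fixes f g :: "'a :: semiring_0 fps"
  assumes "\<And>m n. f $ m * g $ n = g $ n * f $ m"
  shows "f * g = g * f"
proof (rule fps_ext)
  fix n
  have "(f * g) $ n = (\<Sum>i=0..n. g $ (n - i) * f $ i)"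
    by (simp add: fps_mult_nth assms)
  also have "\<dots> = (g * f) $ n"
    unfolding fps_mult_nth
    by (rule sum.reindex_bij_witness[of _ "\<lambda>i. n - i" "\<lambda>i. n - i"]) auto
  finally show "(f * g) $ n = (g * f) $ n" .
qed

text \<open>Multiplication by a constant series and the commutator with one act coefficientwise, so
  the equation expresses coefficient \<open>Suc n\<close>, up to the factor \<open>Suc n\<close>,
  through coefficient \<open>n\<close> and \<open>w\<close>.\<close>

lemma fps_deriv_commutator_unique:
  fixes f g w :: "'a :: rat_algebra_1 fps"
  assumes f: "fps_deriv f = fps_const a * (commutator f (fps_const c) + w)"
    and g: "fps_deriv g = fps_const a * (commutator g (fps_const c) + w)"
    and "f $ 0 = g $ 0"
  shows "f = g"
proof (rule fps_ext)
  fix n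
  show "f $ n = g $ n"
  proof (induction n)
    case (Suc n)
    have "fps_deriv f $ n = fps_deriv g $ n"
      by (simp only: f g fps_mult_left_const_nth fps_add_nth fps_nth_commutator_const Suc)
    then have "of_nat (Suc n) * f $ Suc n = of_nat (Suc n) * g $ Suc n"
      by (simp only: fps_deriv_nth Suc_eq_plus1)
    then show ?case by (rule of_nat_Suc_mult_cancel)
  qed fact
qed

section \<open>The double sequence and the expansion of \<open>(x * F) ^ l\<close>\<close>

lemma A_seq_eq_0: "l < s \<Longrightarrow> A_seq F D s l = 0"
  by (induction F D s l rule: A_seq.induct) auto

lemma A_seq_0_Suc:
  assumes "D 0 = 0" "D 1 = 0"
  shows "A_seq F D 0 (Suc l) = 0"
  by (induction l) (simp_all add: assms)

lemma A_seq_Suc_Suc: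
  assumes "D 0 = 0"
  shows "A_seq F D (Suc s) (Suc l) = F * (D (A_seq F D (Suc s) l) + A_seq F D s l)"
  using assms by (auto simp: A_seq_eq_0)

text \<open>Membership in \<open>S\<close> is the source of all later commutation facts about the
  entries.\<close>

lemma A_seq_mem:
  assumes S: "rat_subalgebra S" and D: "\<And>r. r \<in> S \<Longrightarrow> D r \<in> S" and F: "F \<in> S"
  shows "A_seq F D s l \<in> S"
proof -
  have "0 \<in> S" "1 \<in> S" "\<And>a b. a \<in> S \<Longrightarrow> b \<in> S \<Longrightarrow> a + b \<in> S"
    "\<And>a b. a \<in> S \<Longrightarrow> b \<in> S \<Longrightarrow> a * b \<in> S"
    using S by (auto simp: rat_subalgebra_def rat_vector.subspace_def)
  then show ?thesis
    using F D by (induction F D s l rule: A_seq.induct) auto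
qed

lemma power_mult_eq_sum_A_seq:
  fixes x F :: "'a :: ring_1"
  defines "D \<equiv> \<lambda>r. commutator r x"
  assumes comm: "\<And>s l. A_seq F D s l * F = F * A_seq F D s l"
    and comm_D: "\<And>s l. D (A_seq F D s l) * F = F * D (A_seq F D s l)"
  shows "(x * F) ^ l = (\<Sum>s\<le>l. x ^ s * A_seq F D s l)"
proof (induction l)
  case (Suc l)
  let ?A = "A_seq F D"
  have D0: "D 0 = 0" by (simp add: D_def commutator_def)
  have "x ^ s * ?A s l * (x * F) = x ^ Suc s * (F * ?A s l) + x ^ s * (F * D (?A s l))" for s
  proof -
    have "x ^ s * ?A s l * (x * F) = x ^ s * (?A s l * x * F)"
      by (simp only: mult.assoc)
    also have "?A s l * x = x * ?A s l + D (?A s l)"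
      by (simp add: D_def commutator_def)
    also have "x ^ s * ((x * ?A s l + D (?A s l)) * F)
        = x ^ Suc s * (?A s l * F) + x ^ s * (D (?A s l) * F)"
      by (simp only: power_Suc2 distrib_left distrib_right mult.assoc)
    finally show ?thesis by (simp only: comm comm_D)
  qed
  then have "(x * F) ^ Suc l
      = (\<Sum>s\<le>l. x ^ Suc s * (F * ?A s l)) + (\<Sum>s\<le>l. x ^ s * (F * D (?A s l)))"
    by (simp only: power_Suc2 Suc sum_distrib_right sum.distrib)
  \<comment> \<open>The added term \<open>s = Suc l\<close> is zero. With it, splitting off
    \<open>s = 0\<close> leaves a sum over the same range and with the same powers of
    \<open>x\<close> as the other sum, so the recursion applies termwise.\<close>
  also have "(\<Sum>s\<le>l. x ^ s * (F * D (?A s l))) = (\<Sum>s\<le>Suc l. x ^ s * (F * D (?A s l)))"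
    by (simp add: A_seq_eq_0 D0)
  also have "\<dots> = F * D (?A 0 l) + (\<Sum>s\<le>l. x ^ Suc s * (F * D (?A (Suc s) l)))"
    by (simp only: sum.atMost_Suc_shift power_0 mult_1_left)
  also have "(\<Sum>s\<le>l. x ^ Suc s * (F * ?A s l)) + \<dots>
      = ?A 0 (Suc l) + (\<Sum>s\<le>l. x ^ Suc s * ?A (Suc s) (Suc l))"
    by (simp only: A_seq_Suc_Suc[of D, OF D0] A_seq.simps(3) distrib_left sum.distrib ac_simps)
  also have "\<dots> = (\<Sum>s\<le>Suc l. x ^ s * ?A s (Suc l))"
    by (simp only: sum.atMost_Suc_shift power_0 mult_1_left)
  finally show ?case .
qed simp

section \<open>Exponential generating functions of the rows\<close>

text \<open>The series \<open>G s\<close> of the overview. For \<open>s = 1\<close> it is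
  \<open>\<alpha>\<close>, whose constant term is zero because
  \<open>A_seq F D 1 0 = 0\<close>.\<close>

definition A_egf :: "'a :: rat_algebra_1 \<Rightarrow> ('a \<Rightarrow> 'a) \<Rightarrow> nat \<Rightarrow> 'a fps" where
  "A_egf F D s = Abs_fps (\<lambda>l. (1 / fact l) *\<^sub>Q A_seq F D s l)"

lemma A_egf_0:
  assumes "D 0 = 0" "D 1 = 0"
  shows "A_egf F D 0 = 1"
proof (rule fps_ext)
  show "A_egf F D 0 $ n = 1 $ n" for n
    by (cases n) (simp_all add: A_egf_def A_seq_0_Suc assms scaleQ_one del: A_seq.simps(3))
qed

text \<open>Differentiation shifts an exponential generating function by one index, so this is the
  recursion read off coefficient by coefficient.\<close>

lemma fps_deriv_A_egf_Suc:
  fixes x F :: "'a :: rat_algebra_1"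
  defines "D \<equiv> \<lambda>r. commutator r x"
  shows "fps_deriv (A_egf F D (Suc s))
    = fps_const F * (commutator (A_egf F D (Suc s)) (fps_const x) + A_egf F D s)"
proof (rule fps_ext)
  fix n
  have D0: "D 0 = 0" by (simp add: D_def commutator_def)
  have "fps_deriv (A_egf F D (Suc s)) $ n
      = of_nat (Suc n) * (1 / fact (Suc n)) *\<^sub>Q A_seq F D (Suc s) (Suc n)"
    by (simp only: fps_deriv_nth A_egf_def fps_nth_Abs_fps Suc_eq_plus1)
  also have "\<dots> = (1 / fact n) *\<^sub>Q A_seq F D (Suc s) (Suc n)"
    by (simp only: mult_scaleQ_right scaleQ_of_nat_mult one_div_fact_Suc_mult)
  also have "A_seq F D (Suc s) (Suc n)
      = F * (commutator (A_seq F D (Suc s) n) x + A_seq F D s n)"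
    using A_seq_Suc_Suc[of D, OF D0] by (simp only: D_def)
  finally show "fps_deriv (A_egf F D (Suc s)) $ n
    = (fps_const F * (commutator (A_egf F D (Suc s)) (fps_const x) + A_egf F D s)) $ n"
    by (simp only: A_egf_def fps_mult_left_const_nth fps_add_nth fps_nth_commutator_const
        fps_nth_Abs_fps commutator_scaleQ_left mult_scaleQ_right scaleQ_add_right distrib_left)
qed

lemma A_egf_eq_power:
  fixes S :: "'a :: rat_algebra_1 set" and x F :: 'a
  defines "D \<equiv> \<lambda>r. commutator r x"
  assumes S: "rat_subalgebra S"
    and comm: "\<And>a b. a \<in> S \<Longrightarrow> b \<in> S \<Longrightarrow> a * b = b * a"
    and D: "\<And>r. r \<in> S \<Longrightarrow> D r \<in> S"
    and F: "F \<in> S"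
  shows "A_egf F D s = (1 / fact s) *\<^sub>Q A_egf F D 1 ^ s"
proof -
  have D01: "D 0 = 0" "D 1 = 0" by (simp_all add: D_def commutator_def)
  show ?thesis
  proof (induction s)
    case 0
    show ?case by (simp add: A_egf_0 D01 scaleQ_one)
  next
    case (Suc s)
    define \<alpha> where "\<alpha> = A_egf F D 1"
    define d where "d = (\<lambda>g. commutator g (fps_const x))"
    have scale: "c *\<^sub>Q a \<in> S" if "a \<in> S" for c a
      using S that by (auto simp: rat_subalgebra_def rat_vector.subspace_def)
    have mult: "a * b \<in> S" if "a \<in> S" "b \<in> S" for a b
      using S that by (auto simp: rat_subalgebra_def)
    have add: "a + b \<in> S" if "a \<in> S" "b \<in> S" for a b
      using S that by (auto simp: rat_subalgebra_def rat_vector.subspace_def)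
    have one: "1 \<in> S" "0 \<in> S"
      using S by (auto simp: rat_subalgebra_def rat_vector.subspace_def)
    have \<alpha>_mem: "\<alpha> $ n \<in> S" for n
      by (simp add: \<alpha>_def A_egf_def scale A_seq_mem[OF S D F])
    have d_mem: "d \<alpha> $ n \<in> S" for n
      using D[OF \<alpha>_mem] by (simp add: d_def D_def fps_nth_commutator_const)
    \<comment> \<open>The row equation for \<open>s = 0\<close>, where the inhomogeneous term
      \<open>A_egf F D 0\<close> is \<open>1\<close>.\<close>
    have \<alpha>': "fps_deriv \<alpha> = fps_const F * (d \<alpha> + 1)"
      using fps_deriv_A_egf_Suc[of F x 0] A_egf_0[of D F, OF D01]
      unfolding D_def[symmetric] by (simp only: \<alpha>_def d_def One_nat_def)
    have \<alpha>_d: "\<alpha> * d \<alpha> = d \<alpha> * \<alpha>"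
      by (intro fps_mult_commuteI comm \<alpha>_mem d_mem)
    have "\<alpha> * fps_const F = fps_const F * \<alpha>"
      using comm[OF \<alpha>_mem F] by (simp add: fps_eq_iff)
    then have \<alpha>_F: "\<alpha> ^ n * fps_const F = fps_const F * \<alpha> ^ n" for n
      by (rule power_commuting_commutes)
    have \<alpha>_\<alpha>': "\<alpha> * fps_deriv \<alpha> = fps_deriv \<alpha> * \<alpha>"
    proof (intro fps_mult_commuteI comm \<alpha>_mem)
      show "fps_deriv \<alpha> $ n \<in> S" for n
        unfolding \<alpha>' by (simp add: mult F add d_mem one)
    qed
    \<comment> \<open>The candidate for the next row; it remains to show that it solves the
      differential equation of that row.\<close>
    define v where "v = (1 / fact (Suc s)) *\<^sub>Q \<alpha> ^ Suc s"
    have "fps_deriv v = (1 / fact s) *\<^sub>Q (\<alpha> ^ s * fps_deriv \<alpha>)"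
      unfolding v_def fps_deriv_scaleQ
        derivation_power_Suc[of fps_deriv, OF fps_deriv_mult \<alpha>_\<alpha>']
      by (simp only: scaleQ_of_nat_mult one_div_fact_Suc_mult)
    also have "\<alpha> ^ s * fps_deriv \<alpha> = fps_const F * (\<alpha> ^ s * d \<alpha> + \<alpha> ^ s)"
      unfolding \<alpha>' mult.assoc[symmetric] \<alpha>_F by (simp only: distrib_left mult.assoc mult_1_right)
    also have "(1 / fact s) *\<^sub>Q (fps_const F * (\<alpha> ^ s * d \<alpha> + \<alpha> ^ s))
        = fps_const F * ((1 / fact s) *\<^sub>Q (\<alpha> ^ s * d \<alpha>) + (1 / fact s) *\<^sub>Q \<alpha> ^ s)"
      by (simp only: distrib_left mult_scaleQ_right scaleQ_add_right)
    \<comment> \<open>The power rule once more, now for the commutator and read backwards.\<close>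
    also have "(1 / fact s) *\<^sub>Q (\<alpha> ^ s * d \<alpha>) = d v"
    proof -
      have "d (a * b) = a * d b + d a * b" for a b
        by (simp add: d_def commutator_mult_left)
      from derivation_power_Suc[of d, OF this \<alpha>_d]
      have "d (\<alpha> ^ Suc s) = of_nat (Suc s) * (\<alpha> ^ s * d \<alpha>)" .
      moreover have "d v = (1 / fact (Suc s)) *\<^sub>Q d (\<alpha> ^ Suc s)"
        by (simp only: v_def d_def commutator_scaleQ_left)
      ultimately show ?thesis
        by (simp only: scaleQ_of_nat_mult one_div_fact_Suc_mult)
    qed
    finally have v': "fps_deriv v = fps_const F * (commutator v (fps_const x) + A_egf F D s)"
      by (simp only: d_def Suc \<alpha>_def)
    \<comment> \<open>Both constant terms are zero: \<open>A_seq F D (Suc s) 0 = 0\<close>, and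
      \<open>\<alpha>\<close> has no constant term.\<close>
    have "A_egf F D (Suc s) $ 0 = v $ 0"
      by (simp add: v_def \<alpha>_def A_egf_def)
    with fps_deriv_A_egf_Suc[of F x s, folded D_def] v' have "A_egf F D (Suc s) = v"
      by (rule fps_deriv_commutator_unique)
    then show ?case by (simp only: v_def \<alpha>_def)
  qed
qed

theorem corollary2:
  fixes S :: "'a :: rat_algebra_1 set" and x F :: 'a
    and D :: "'a \<Rightarrow> 'a" and \<alpha> :: "'a fps"
  assumes "rat_subalgebra S"
    and "\<And>a b. a \<in> S \<Longrightarrow> b \<in> S \<Longrightarrow> a * b = b * a"
    and "D = (\<lambda>r. commutator r x)"
    and "\<And>r. r \<in> S \<Longrightarrow> D r \<in> S"
    and "F \<in> S"
    and "\<alpha> = Abs_fps (\<lambda>l. if l = 0 then 0 else (1 / fact l) *\<^sub>Q A_seq F D 1 l)"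
  shows "(\<lambda>s. (1 / fact s) *\<^sub>Q (fps_const x ^ s * \<alpha> ^ s))
           sums exp_series (fps_X * fps_const (x * F))"
proof -
  have mem: "A_seq F D s l \<in> S" for s l
    by (rule A_seq_mem) (use assms in auto)
  have \<alpha>: "\<alpha> = A_egf F D 1"
    by (simp add: assms(6) A_egf_def fps_eq_iff)
  have term_nth: "((1 / fact s) *\<^sub>Q (fps_const x ^ s * \<alpha> ^ s)) $ n
      = (1 / fact n) *\<^sub>Q (x ^ s * A_seq F D s n)" for s n
  proof -
    have "(1 / fact s) *\<^sub>Q (fps_const x ^ s * \<alpha> ^ s) = fps_const (x ^ s) * A_egf F D s"
      using A_egf_eq_power[of S x F s] assms
      by (simp add: \<alpha> mult_scaleQ_right)
    then show ?thesis by (simp add: A_egf_def mult_scaleQ_right)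
  qed
  have power: "(x * F) ^ n = (\<Sum>s\<le>n. x ^ s * A_seq F D s n)" for n
    using power_mult_eq_sum_A_seq[of F x n] assms(2-5) mem by metis
  have "exp_series (fps_X * fps_const (x * F)) = Abs_fps (\<lambda>n. (1 / fact n) *\<^sub>Q (x * F) ^ n)"
    unfolding exp_series_def by (rule sums_unique[symmetric, OF exp_series_fps_X_const_sums])
  moreover have "(\<lambda>s. (1 / fact s) *\<^sub>Q (fps_const x ^ s * \<alpha> ^ s))
      sums Abs_fps (\<lambda>n. (1 / fact n) *\<^sub>Q (x * F) ^ n)"
    unfolding sums_def
  proof (rule tendsto_fpsI)
    fix n
    \<comment> \<open>Convergence is coefficientwise: as \<open>A_seq F D s n = 0\<close> for
      \<open>s > n\<close>, coefficient \<open>n\<close> of the partial sums is stationary once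
      \<open>N > n\<close>.\<close>
    have "(\<Sum>s<N. (1 / fact s) *\<^sub>Q (fps_const x ^ s * \<alpha> ^ s)) $ n = (1 / fact n) *\<^sub>Q (x * F) ^ n"
      if "N > n" for N
    proof -
      have "(\<Sum>s<N. (1 / fact s) *\<^sub>Q (fps_const x ^ s * \<alpha> ^ s)) $ n
          = (1 / fact n) *\<^sub>Q (\<Sum>s<N. x ^ s * A_seq F D s n)"
        by (simp only: fps_sum_nth term_nth rat_vector.scale_sum_right)
      also have "(\<Sum>s<N. x ^ s * A_seq F D s n) = (\<Sum>s\<le>n. x ^ s * A_seq F D s n)"
        using that by (intro sum.mono_neutral_right) (auto simp: A_seq_eq_0)
      finally show ?thesis by (simp only: power)
    qed
    then show "\<forall>\<^sub>F N in sequentially. (\<Sum>s<N. (1 / fact s) *\<^sub>Q (fps_const x ^ s * \<alpha> ^ s)) $ n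
        = Abs_fps (\<lambda>n. (1 / fact n) *\<^sub>Q (x * F) ^ n) $ n"
      by (auto intro: eventually_sequentiallyI[of "Suc n"])
  qed
  ultimately show ?thesis by simp
qed

end
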